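(* Let $n$ be a positive integer, $R>0$, and let $B^n(R)=\{u=(u^1,\ldots,u^n)\in\mathbb{R}^n : |u|<R\}$. Let $\psi: B^n(R)\to\mathbb{R}$ be a $C^2$ function whose graph $\Gamma_\psi$ in the Lorentz-Minkowski space $\mathbb{R}^{n+1}_1$ is space-like or time-like. Suppose there exist constants $M>0$ and $k\in\mathbb{R}$ such that $$\frac{|\nabla\psi|}{\sqrt{\bigl|1-|\nabla\psi|^2\bigr|}}\le M\bigl((u^1)^2+\cdots+(u^n)^2\bigr)^k\quad\text{on } B^n(R).$$ If the mean curvature $H$ of $\Gamma_\psi$ satisfies $|H|\ge\alpha>0$ on $B^n(R)$ for some constant $\alpha$, then $$\alpha\le M R^{2k-1}.$$
   Context: $\mathbb{R}^{n+1}_1$ is $\mathbb{R}^{n+1}$ with the Lorentz metric $\langle x,y\rangle_L=x^1y^1+\cdots+x^ny^n-x^{n+1}y^{n+1}$. For a $C^2$ function $\psi$ on a domain $\Omega\subset\mathbb{R}^n$, its graph is $\Gamma_\psi=\{(u,\psi(u)) : u\in\Omega\}\subset\mathbb{R}^{n+1}_1$, and $\nabla\psi=(\psi_{u^1},\ldots,\psi_{u^n})$ is the Euclidean gradient, with Euclidean norm $|\nabla\psi|$. The graph is space-like (induced metric Riemannian) when $|\nabla\psi|<1$ everywhere on $\Omega$, and time-like (induced metric Lorentzian) when $|\nabla\psi|>1$ everywhere on $\Omega$. The mean curvature $H$ of $\Gamma_\psi$, regarded as a function on $\Omega$, is given by $$nH=\operatorname{div}\left(\frac{\nabla\psi}{\sqrt{1-|\nabla\psi|^2}}\right)\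 \text{(space-like case)},\qquad nH=\operatorname{div}\left(\frac{\nabla\psi}{\sqrt{|\nabla\psi|^2-1}}\right)\ \text{(time-like case)}.$$ Convention at the origin: $0^k=0$ if $k>0$, $0^0=1$, and $0^k=+\infty$ if $k<0$ (so the bound imposes no condition at the origin when $k<0$). *)

theory Defs
  imports "HOL-Analysis.Analysis"
begin

text \<open>Second-order continuous differentiability, for open \<open>S\<close> only: the derivatives are taken at
  the full filter \<open>at x\<close>, not within \<open>S\<close>.\<close>

definition C2_on :: "('a::real_normed_vector \<Rightarrow> real) \<Rightarrow> 'a set \<Rightarrow> bool" where
  "C2_on f S \<longleftrightarrow>
     (\<exists>(f' :: 'a \<Rightarrow> 'a \<Rightarrow>\<^sub>L real) (f'' :: 'a \<Rightarrow> 'a \<Rightarrow>\<^sub>L ('a \<Rightarrow>\<^sub>L real)).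
        (\<forall>x\<in>S. (f has_derivative blinfun_apply (f' x)) (at x)) \<and>
        (\<forall>x\<in>S. (f' has_derivative blinfun_apply (f'' x)) (at x)) \<and>
        continuous_on S f'')"

definition partial_deriv :: "'n \<Rightarrow> (real ^ 'n \<Rightarrow> real) \<Rightarrow> real ^ 'n \<Rightarrow> real" where
  "partial_deriv i f u = deriv (\<lambda>t. f (u + t *\<^sub>R axis i 1)) 0"

definition grad :: "(real ^ 'n \<Rightarrow> real) \<Rightarrow> real ^ 'n \<Rightarrow> real ^ 'n" where
  "grad f u = (\<chi> i. partial_deriv i f u)"

definition divergence :: "(real ^ 'n \<Rightarrow> real ^ 'n) \<Rightarrow> real ^ 'n \<Rightarrow> real" where
  "divergence F u = (\<Sum>i\<in>UNIV. partial_deriv i (\<lambda>x. F x $ i) u)"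

text \<open>The graph of \<open>\<psi>\<close> over \<open>\<Omega>\<close> in the Lorentz-Minkowski space with metric
  \<open>dx\<^sub>1\<^sup>2 + \<dots> + dx\<^sub>n\<^sup>2 - dx\<^sub>n\<^sub>+\<^sub>1\<^sup>2\<close>. The induced metric at \<open>u\<close> is
  \<open>v \<bullet> w - (grad \<psi> u \<bullet> v) * (grad \<psi> u \<bullet> w)\<close>, which is Riemannian iff \<open>norm (grad \<psi> u) < 1\<close> and
  Lorentzian iff \<open>norm (grad \<psi> u) > 1\<close>.\<close>

definition spacelike_graph :: "(real ^ 'n) set \<Rightarrow> (real ^ 'n \<Rightarrow> real) \<Rightarrow> bool" where
  "spacelike_graph \<Omega> \<psi> \<longleftrightarrow> (\<forall>u\<in>\<Omega>. norm (grad \<psi> u) < 1)"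

definition timelike_graph :: "(real ^ 'n) set \<Rightarrow> (real ^ 'n \<Rightarrow> real) \<Rightarrow> bool" where
  "timelike_graph \<Omega> \<psi> \<longleftrightarrow> (\<forall>u\<in>\<Omega>. norm (grad \<psi> u) > 1)"

text \<open>The mean curvature \<open>H\<close> of the graph, as a function on \<open>\<Omega>\<close>. The second branch is the
  formula for time-like graphs; the value carries no meaning if the graph is neither space-like
  nor time-like.\<close>

definition graph_mean_curvature ::
    "(real ^ 'n) set \<Rightarrow> (real ^ 'n \<Rightarrow> real) \<Rightarrow> real ^ 'n \<Rightarrow> real" where
  "graph_mean_curvature \<Omega> \<psi> u =
     (if spacelike_graph \<Omega> \<psi>
      then divergence (\<lambda>x. grad \<psi> x /\<^sub>R sqrt (1 - (norm (grad \<psi> x))\<^sup>2)) u / real CARD('n)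
      else divergence (\<lambda>x. grad \<psi> x /\<^sub>R sqrt ((norm (grad \<psi> x))\<^sup>2 - 1)) u / real CARD('n))"

text \<open>The power \<open>x\<^sup>k\<close> for \<open>x \<ge> 0\<close> and real \<open>k\<close>, with \<open>0\<^sup>0 = 1\<close> and \<open>0\<^sup>k = \<infinity>\<close> for \<open>k < 0\<close>
  (in contrast to \<^const>\<open>powr\<close>, where \<open>0 powr k = 0\<close> for all \<open>k\<close>).\<close>

definition ext_power :: "real \<Rightarrow> real \<Rightarrow> ereal" where
  "ext_power x k =
     (if x = 0 then (if k > 0 then 0 else if k = 0 then 1 else \<infinity>) else ereal (x powr k))"

end

theory Submission
  imports Defs
begin

text \<open>The field \<open>W = grad \<psi> / sqrt \<bar>1 - \<bar>grad \<psi>\<bar>\<^sup>2\<bar>\<close> is \<open>C\<^sup>1\<close> with divergence \<open>n H\<close>, which has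
  constant sign, say \<open>n H \<ge> n \<alpha>\<close>. Then \<open>V x = W x - \<alpha> x\<close> has nonnegative divergence, whereas
  \<open>\<alpha> > M R\<^sup>2\<^sup>k\<^sup>-\<^sup>1\<close> would make \<open>V\<close> point strictly inward in a shell \<open>a < \<bar>x\<bar> < R\<close>. For a radial
  cutoff \<open>\<phi>\<close> that decreases in this shell only, \<open>\<phi> V\<close> has compact support, so its divergence
  integrates to 0; but both terms of \<open>\<phi> div V + grad \<phi> \<bullet> V\<close> are nonnegative and the second
  one does not vanish identically.\<close>

section \<open>Integrals over the whole space of compactly supported functions and their
  derivatives\<close>

lemma integrable_compact_support:
  fixes f :: "'a::euclidean_space \<Rightarrow> real"
  assumes "continuous_on UNIV f" and "\<And>x. r \<le> norm x \<Longrightarrow> f x = 0"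
  shows "integrable lborel f"
proof -
  have "integrable lborel (\<lambda>x. indicat_real (cball 0 r) x *\<^sub>R f x)"
    using assms(1) by (intro borel_integrable_compact) (auto intro: continuous_on_subset)
  moreover have "(\<lambda>x. indicat_real (cball 0 r) x *\<^sub>R f x) = f"
    using assms(2) by (fastforce simp: indicator_def)
  ultimately show ?thesis by simp
qed

lemma lborel_integral_translation:
  fixes f :: "'a::euclidean_space \<Rightarrow> real"
  assumes "f \<in> borel_measurable borel"
  shows "(LINT x|lborel. f (x + c)) = (LINT x|lborel. f x)"
  using integral_distr[of "(+) c" lborel borel f] assms
  by (simp add: lborel_distr_plus add.commute)

text \<open>Translation invariance makes every difference quotient of \<open>f\<close> in direction
  \<open>e\<close> integrate to 0. By the mean value theorem the quotients are bounded by a bound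
  for \<open>f'\<close>, and for steps of size at most 1 they live in one fixed ball, so dominated
  convergence carries the value 0 to the limit. No Fubini argument is involved.\<close>

lemma integral_directional_derivative_eq_0:
  fixes f :: "'a::euclidean_space \<Rightarrow> real"
  assumes der: "\<And>x. ((\<lambda>t. f (x + t *\<^sub>R e)) has_real_derivative f' x) (at 0)"
    and cont: "continuous_on UNIV f" "continuous_on UNIV f'"
    and supp: "\<And>x. r \<le> norm x \<Longrightarrow> f x = 0" "\<And>x. r \<le> norm x \<Longrightarrow> f' x = 0"
  shows "(LINT x|lborel. f' x) = 0"
proof -
  define t where "t n = 1 / real (Suc n)" for n
  define s where "s n x = (f (x + t n *\<^sub>R e) - f x) / t n" for n x
  have t: "0 < t n" "t n \<le> 1" for n by (auto simp: t_def)
  have t0: "t \<longlonglongrightarrow> 0"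
    unfolding t_def using LIMSEQ_inverse_real_of_nat by (simp add: inverse_eq_divide)
  have "compact (f' ` cball 0 r)"
    using cont(2) by (intro compact_continuous_image) (auto intro: continuous_on_subset)
  then obtain B where B: "\<And>x. x \<in> cball 0 r \<Longrightarrow> norm (f' x) \<le> B"
    by (metis bounded_iff compact_imp_bounded imageI)
  \<comment> \<open>The absolute value of \<open>B\<close> covers \<open>r < 0\<close>, where the
    ball is empty and \<open>B\<close> may be negative.\<close>
  have B': "\<bar>f' x\<bar> \<le> \<bar>B\<bar>" for x
    using B[of x] supp(2)[of x] by (cases "norm x \<le> r") auto
  \<comment> \<open>The derivative at parameter \<open>u\<close> is the hypothesis at parameter 0
    with base point moved to \<open>x + u *\<^sub>R e\<close>.\<close>
  have der': "((\<lambda>t. f (x + t *\<^sub>R e)) has_real_derivative f' (x + u *\<^sub>R e)) (at u)" for x u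
    using der[of "x + u *\<^sub>R e"] DERIV_shift[of "\<lambda>t. f (x + t *\<^sub>R e)" _ 0 u]
    by (simp add: algebra_simps)
  have quot: "\<bar>s n x\<bar> \<le> \<bar>B\<bar>" for n x
  proof -
    obtain z where "f (x + t n *\<^sub>R e) - f (x + 0 *\<^sub>R e) = (t n - 0) * f' (x + z *\<^sub>R e)"
      using MVT2[of 0 "t n" "\<lambda>t. f (x + t *\<^sub>R e)" "\<lambda>u. f' (x + u *\<^sub>R e)"] t(1) der' by blast
    then show ?thesis using B' t(1)[of n] by (simp add: s_def)
  qed
  have quot0: "s n x = 0" if "norm x > r + norm e" for n x
  proof -
    have "norm (t n *\<^sub>R e) \<le> norm e" using t[of n] by (simp add: mult_left_le_one_le)
    then have "norm (x + t n *\<^sub>R e) \<ge> r"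
      using that norm_diff_ineq[of x "t n *\<^sub>R e"] by simp
    moreover have "norm x \<ge> r" using that norm_ge_zero[of e] by linarith
    ultimately show ?thesis using supp(1) by (simp add: s_def)
  qed
  have [measurable]: "f \<in> borel_measurable borel" "f' \<in> borel_measurable borel"
    using cont by (auto intro: borel_measurable_continuous_onI)
  have [measurable]: "s n \<in> borel_measurable borel" for n
    unfolding s_def by measurable
  have int: "integrable lborel f" using cont supp by (intro integrable_compact_support) auto
  have shifted: "integrable lborel (\<lambda>x. f (x + c))" for c
  proof (rule integrable_compact_support)
    show "continuous_on UNIV (\<lambda>x. f (x + c))"
      by (intro continuous_on_compose2[OF cont(1)] continuous_intros) auto
    show "f (x + c) = 0" if "r + norm c \<le> norm x" for x
      using that norm_diff_ineq[of x c] by (intro supp) auto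
  qed
  have zero: "(LINT x|lborel. s n x) = 0" for n
    using int shifted by (simp add: s_def lborel_integral_translation)
  have "(\<lambda>n. LINT x|lborel. s n x) \<longlonglongrightarrow> (LINT x|lborel. f' x)"
  proof (rule integral_dominated_convergence)
    show "integrable lborel (\<lambda>x. indicat_real (cball 0 (r + norm e)) x *\<^sub>R \<bar>B\<bar>)"
      by (intro borel_integrable_compact) auto
    show "AE x in lborel. (\<lambda>n. s n x) \<longlonglongrightarrow> f' x"
    proof (rule AE_I2)
      fix x
      have "((\<lambda>h. (f (x + h *\<^sub>R e) - f x) / h) \<longlongrightarrow> f' x) (at 0)"
        using der[of x] by (simp add: DERIV_def)
      moreover have "filterlim t (at 0) sequentially"
        using t0 t(1) by (auto simp: filterlim_at less_le intro!: always_eventually)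
      ultimately show "(\<lambda>n. s n x) \<longlonglongrightarrow> f' x"
        unfolding s_def by (rule filterlim_compose)
    qed
    show "AE x in lborel. norm (s n x) \<le> indicat_real (cball 0 (r + norm e)) x *\<^sub>R \<bar>B\<bar>" for n
    proof (rule AE_I2)
      fix x show "norm (s n x) \<le> indicat_real (cball 0 (r + norm e)) x *\<^sub>R \<bar>B\<bar>"
        using quot[of n x] quot0[of x n] by (cases "norm x \<le> r + norm e") (auto simp: indicator_def)
    qed
  qed auto
  then show ?thesis using zero by (simp add: LIMSEQ_const_iff)
qed

text \<open>The integral gives vanishing almost everywhere only; by continuity the exceptional set
  is open, and a nonempty open set is not negligible.\<close>

lemma continuous_nonneg_integral_eq_0:
  fixes f :: "'a::euclidean_space \<Rightarrow> real"
  assumes cont: "continuous_on UNIV f" and "integrable lborel f" and nonneg: "\<And>x. f x \<ge> 0"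
    and "(LINT x|lborel. f x) = 0"
  shows "f x = 0"
proof -
  have "AE x in lborel. f x = 0"
    using assms by (subst (asm) integral_nonneg_eq_0_iff_AE) auto
  moreover have op: "open {x. f x \<noteq> 0}"
    using cont by (intro open_Collect_neq) auto
  ultimately have "{x. f x \<noteq> 0} \<in> null_sets lborel"
    by (simp add: AE_iff_null_sets)
  then have "negligible {x. f x \<noteq> 0}"
    by (simp add: negligible_iff_null_sets null_sets_completionI)
  then show ?thesis using open_not_negligible[OF op] by auto
qed

section \<open>Cutoff functions and a weak divergence theorem\<close>

text \<open>The profile is built from the \<open>C\<^sup>1\<close> function \<open>q\<close>, the
  square of the positive part, applied twice: the inner \<open>q\<close> makes \<open>h\<close>
  vanish from \<open>b\<close> on, the outer one makes it constantly 1 up to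
  \<open>a\<close>.\<close>

lemma C1_cutoff:
  fixes a b :: real
  assumes "a < b"
  obtains h h' :: "real \<Rightarrow> real" where
    "\<And>s. (h has_real_derivative h' s) (at s)" "continuous_on UNIV h'" "\<And>s. h s \<ge> 0"
    "\<And>s. s \<ge> b \<Longrightarrow> h s = 0" "\<And>s. s \<ge> b \<Longrightarrow> h' s = 0" "\<And>s. s \<le> a \<Longrightarrow> h' s = 0"
    "\<And>s. a < s \<Longrightarrow> s < b \<Longrightarrow> h' s < 0"
proof -
  define q where "q x = (max 0 x)\<^sup>2" for x :: real
  have q: "(q has_real_derivative 2 * max 0 x) (at x)" for x
  proof -
    consider "x > 0" | "x < 0" | "x = 0" by linarith
    then show ?thesis
    proof cases
      case 1
      have "((\<lambda>x. x\<^sup>2) has_real_derivative 2 * max 0 x) (at x)"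
        using 1 by (auto intro!: derivative_eq_intros)
      then show ?thesis
        by (rule DERIV_cong_ev[THEN iffD1, rotated 3])
          (use 1 in \<open>auto simp: q_def intro!: eventually_nhds_in_open[of "{0<..}", THEN eventually_mono]\<close>)
    next
      case 2
      have "((\<lambda>x. 0) has_real_derivative 2 * max 0 x) (at x)"
        using 2 by auto
      then show ?thesis
        by (rule DERIV_cong_ev[THEN iffD1, rotated 3])
          (use 2 in \<open>auto simp: q_def intro!: eventually_nhds_in_open[of "{..<0}", THEN eventually_mono]\<close>)
    next
      case 3
      have "((\<lambda>h. max 0 h :: real) \<longlongrightarrow> max 0 0) (at 0)"
        by (intro tendsto_intros)
      \<comment> \<open>This holds at \<open>h = 0\<close> as well, since division by zero yields
        0.\<close>
      moreover have "q h / h = max 0 h" for h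
        by (auto simp: q_def max_def power2_eq_square)
      ultimately show ?thesis using 3 by (simp add: DERIV_def) (simp add: q_def)
    qed
  qed
  \<comment> \<open>The normalization for which \<open>q (b - s) / c\<close> reaches 1 exactly at
    \<open>s = a\<close>.\<close>
  define c where "c = (b - a)\<^sup>2"
  have c: "c > 0" using assms by (simp add: c_def)
  define h where "h s = 1 - q (1 - q (b - s) / c)" for s
  define h' where "h' s = - (4 / c) * max 0 (1 - q (b - s) / c) * max 0 (b - s)" for s
  have qlt: "q (b - s) < c" if "a < s" for s
    using that assms by (auto simp: q_def c_def max_def intro!: power_strict_mono)
  have qge: "q (b - s) \<ge> c" if "s \<le> a" for s
    using that assms by (auto simp: q_def c_def max_def intro!: power_mono)
  show ?thesis
  proof
    show "(h has_real_derivative h' s) (at s)" for s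
      unfolding h_def h'_def using c
      by (auto intro!: derivative_eq_intros DERIV_chain2[OF q] simp: field_simps)
    show "continuous_on UNIV h'"
      unfolding h'_def q_def using c by (intro continuous_intros) auto
    show "h s \<ge> 0" for s
    proof -
      have "max 0 (1 - q (b - s) / c) \<le> 1" using c by (simp add: q_def)
      then have "(max 0 (1 - q (b - s) / c))\<^sup>2 \<le> 1" by (intro power_le_one) auto
      then show ?thesis by (simp add: h_def q_def)
    qed
    show "h s = 0" if "s \<ge> b" for s using that by (simp add: h_def q_def)
    show "h' s = 0" if "s \<ge> b" for s using that by (simp add: h'_def)
    show "h' s = 0" if "s \<le> a" for s using qge[OF that] c by (simp add: h'_def)
    show "h' s < 0" if "a < s" "s < b" for s
    proof -
      have "4 / c * max 0 (1 - q (b - s) / c) * max 0 (b - s) > 0"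
        using qlt[OF that(1)] c that by (intro mult_pos_pos) auto
      then show ?thesis unfolding h'_def by linarith
    qed
  qed
qed

text \<open>The ball of radius \<open>R\<close> and the complement of the closed ball of radius
  \<open>b\<close> are open, cover the space because \<open>b < R\<close>, and the extension is
  continuous on each.\<close>

lemma continuous_on_extend_by_0:
  fixes f :: "'a::real_normed_vector \<Rightarrow> real"
  assumes "continuous_on (ball 0 R) f" and "b < R"
    and "\<And>x. b \<le> norm x \<Longrightarrow> norm x < R \<Longrightarrow> f x = 0"
  shows "continuous_on UNIV (\<lambda>x. if x \<in> ball 0 R then f x else 0)" (is "continuous_on _ ?g")
proof -
  have "open (- cball 0 b :: 'a set)" by auto
  moreover have "continuous_on (ball 0 R) ?g"
    using assms(1) by (rule continuous_on_eq) auto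
  moreover have "continuous_on (- cball 0 b) ?g"
    by (rule continuous_on_eq[of _ "\<lambda>_. 0"]) (use assms(3) in auto)
  moreover have "ball 0 R \<union> - cball 0 b = (UNIV :: 'a set)"
    using assms(2) by auto
  ultimately show ?thesis
    using continuous_on_open_Un[of "ball 0 R" "- cball 0 b" ?g] by simp
qed

text \<open>A weak form of the divergence theorem: the field is multiplied by a radial cutoff whose
  gradient lives in the shell \<open>a < norm x < R\<close>, so no surface integral is needed.\<close>

lemma divergence_nonneg_imp_outward:
  fixes V :: "'a::euclidean_space \<Rightarrow> 'a"
  assumes V: "\<And>x. x \<in> ball 0 R \<Longrightarrow> (V has_derivative DV x) (at x)"
    and cont: "\<And>e. e \<in> Basis \<Longrightarrow> continuous_on (ball 0 R) (\<lambda>x. DV x e)"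
    and div: "\<And>x. x \<in> ball 0 R \<Longrightarrow> (\<Sum>e\<in>Basis. DV x e \<bullet> e) \<ge> 0"
    and "0 \<le> a" "a < R"
  shows "\<exists>x. a < norm x \<and> norm x < R \<and> x \<bullet> V x \<ge> 0"
proof (rule ccontr)
  assume "\<not> ?thesis"
  then have inward: "x \<bullet> V x < 0" if "a < norm x" "norm x < R" for x
    using that by force
  \<comment> \<open>Stopping the cutoff halfway keeps its support away from the sphere of radius
    \<open>R\<close>, where nothing is known about \<open>V\<close>.\<close>
  define b where "b = (a + R) / 2"
  have b: "a < b" "b < R" "0 < b" using \<open>0 \<le> a\<close> \<open>a < R\<close> by (auto simp: b_def)
  have ab: "a\<^sup>2 < b\<^sup>2" using b \<open>0 \<le> a\<close> by (intro power_strict_mono) auto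
  \<comment> \<open>The cutoff is evaluated at \<open>x \<bullet> x\<close>, which is smooth also at
    the origin; hence the squared thresholds.\<close>
  obtain h h' :: "real \<Rightarrow> real" where h:
    "\<And>s. (h has_real_derivative h' s) (at s)" "continuous_on UNIV h'" "\<And>s. h s \<ge> 0"
    "\<And>s. s \<ge> b\<^sup>2 \<Longrightarrow> h s = 0" "\<And>s. s \<ge> b\<^sup>2 \<Longrightarrow> h' s = 0" "\<And>s. s \<le> a\<^sup>2 \<Longrightarrow> h' s = 0"
    "\<And>s. a\<^sup>2 < s \<Longrightarrow> s < b\<^sup>2 \<Longrightarrow> h' s < 0"
    using C1_cutoff[OF ab] by metis
  have conth: "continuous_on UNIV h"
    using h(1) by (meson DERIV_isCont continuous_at_imp_continuous_on)
  have h0: "h (x \<bullet> x) = 0" "h' (x \<bullet> x) = 0" if "b \<le> norm x" for x :: 'a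
    using that b h(4,5)[of "x \<bullet> x"] power_mono[of b "norm x" 2] by (auto simp: power2_norm_eq_inner)
  \<comment> \<open>\<open>F e\<close> is the \<open>e\<close>-component of the cut-off field, and
    \<open>F' e\<close> below is its derivative in direction \<open>e\<close>, so the sum of the
    \<open>F' e\<close> over \<open>Basis\<close> is the divergence.\<close>
  define F where "F e x = (if x \<in> ball 0 R then h (x \<bullet> x) * (V x \<bullet> e) else 0)" for e x
  define F' where "F' e x = (if x \<in> ball 0 R
      then h (x \<bullet> x) * (DV x e \<bullet> e) + 2 * h' (x \<bullet> x) * (x \<bullet> e) * (V x \<bullet> e) else 0)" for e x
  have contV: "continuous_on (ball 0 R) V"
    using V by (meson continuous_at_imp_continuous_on has_derivative_continuous)
  have contF: "continuous_on UNIV (F e)" for e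
    unfolding F_def using b h0 contV
    by (intro continuous_on_extend_by_0 continuous_intros continuous_on_compose2[OF conth]) auto
  have contF': "continuous_on UNIV (F' e)" if "e \<in> Basis" for e
    unfolding F'_def using b h0 contV cont[OF that]
    by (intro continuous_on_extend_by_0 continuous_intros
        continuous_on_compose2[OF conth] continuous_on_compose2[OF h(2)]) auto
  have derF: "((\<lambda>t. F e (x + t *\<^sub>R e)) has_real_derivative F' e x) (at 0)" for e x
  proof (cases "norm x < R")
    case True
    have V': "((\<lambda>t. V (x + t *\<^sub>R e)) has_derivative (\<lambda>t. t *\<^sub>R DV x e)) (at 0)"
    proof -
      have lin: "linear (DV x)"
        using V[of x] True by (simp add: has_derivative_linear)
      have "((\<lambda>t. x + t *\<^sub>R e) has_derivative (\<lambda>t. t *\<^sub>R e)) (at 0)"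
        by (auto intro!: derivative_eq_intros)
      from has_derivative_compose[OF this, of V "DV x"] show ?thesis
        using V[of x] True lin by (simp add: linear_cmul)
    qed
    have hh: "((\<lambda>t. h ((x + t *\<^sub>R e) \<bullet> (x + t *\<^sub>R e))) has_real_derivative h' (x \<bullet> x) * (2 * (x \<bullet> e))) (at 0)"
    proof -
      have "((\<lambda>t. (x + t *\<^sub>R e) \<bullet> (x + t *\<^sub>R e)) has_real_derivative 2 * (x \<bullet> e)) (at 0)"
        unfolding has_field_derivative_def
        by (auto intro!: derivative_eq_intros simp: inner_commute algebra_simps)
      then show ?thesis using DERIV_chain2[of h "h' (x \<bullet> x)"] h(1) by fastforce
    qed
    have Ve: "((\<lambda>t. V (x + t *\<^sub>R e) \<bullet> e) has_real_derivative DV x e \<bullet> e) (at 0)"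
      unfolding has_field_derivative_def
      by (rule has_derivative_eq_rhs, rule has_derivative_inner_left[OF V']) (simp add: fun_eq_iff)
    have "((\<lambda>t. h ((x + t *\<^sub>R e) \<bullet> (x + t *\<^sub>R e)) * (V (x + t *\<^sub>R e) \<bullet> e)) has_real_derivative F' e x) (at 0)"
      by (rule DERIV_cong[OF DERIV_mult[OF hh Ve]]) (use True in \<open>simp add: F'_def algebra_simps\<close>)
    moreover have "eventually (\<lambda>t. x + t *\<^sub>R e \<in> ball 0 R) (nhds 0)"
    proof -
      have "continuous_on UNIV (\<lambda>t. x + t *\<^sub>R e)" by (intro continuous_intros)
      then have "open ((\<lambda>t. x + t *\<^sub>R e) -` ball 0 R)" by (intro open_vimage) auto
      then show ?thesis
        using True eventually_nhds_in_open[of "(\<lambda>t. x + t *\<^sub>R e) -` ball 0 R" 0] by simp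
    qed
    then have "eventually (\<lambda>t. F e (x + t *\<^sub>R e) = h ((x + t *\<^sub>R e) \<bullet> (x + t *\<^sub>R e)) * (V (x + t *\<^sub>R e) \<bullet> e)) (nhds 0)"
      by (rule eventually_mono) (simp add: F_def)
    ultimately show ?thesis
      by (subst DERIV_cong_ev[OF refl _ refl])
  next
    case False
    \<comment> \<open>A point outside the ball, even on its boundary, has a neighbourhood in
      \<open>- cball 0 b\<close>, where \<open>F e\<close> is identically 0.\<close>
    have "continuous_on UNIV (\<lambda>t. x + t *\<^sub>R e)" by (intro continuous_intros)
    then have "open ((\<lambda>t. x + t *\<^sub>R e) -` (- cball 0 b))" by (intro open_vimage) auto
    then have "eventually (\<lambda>t. x + t *\<^sub>R e \<in> - cball 0 b) (nhds 0)"
      using False b eventually_nhds_in_open[of "(\<lambda>t. x + t *\<^sub>R e) -` (- cball 0 b)" 0] by simp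
    then have "eventually (\<lambda>t. F e (x + t *\<^sub>R e) = 0) (nhds 0)"
      by (rule eventually_mono) (use h0 in \<open>auto simp: F_def\<close>)
    then have "((\<lambda>t. F e (x + t *\<^sub>R e)) has_real_derivative 0) (at 0)"
      using DERIV_cong_ev[OF refl _ refl, of "\<lambda>t. F e (x + t *\<^sub>R e)" "\<lambda>_. 0"] by simp
    then show ?thesis using False by (simp add: F'_def)
  qed
  have supp: "F e x = 0" "F' e x = 0" if "b \<le> norm x" for e x
    using h0[OF that] by (auto simp: F_def F'_def)
  have intF': "integrable lborel (F' e)" if "e \<in> Basis" for e
    using integrable_compact_support[OF contF'[OF that] supp(2)] .
  have "(LINT x|lborel. F' e x) = 0" if "e \<in> Basis" for e
    using integral_directional_derivative_eq_0[OF derF contF contF'[OF that] supp] by simp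
  then have int0: "(LINT x|lborel. (\<Sum>e\<in>Basis. F' e x)) = 0"
    using intF' by (simp add: Bochner_Integration.integral_sum)
  have sumF': "(\<Sum>e\<in>Basis. F' e x) = h (x \<bullet> x) * (\<Sum>e\<in>Basis. DV x e \<bullet> e) + 2 * (h' (x \<bullet> x) * (x \<bullet> V x))"
    if "norm x < R" for x
    using that by (simp add: F'_def sum.distrib sum_distrib_left euclidean_inner[of x "V x"] mult_ac)
  \<comment> \<open>In the shell between \<open>a\<close> and \<open>b\<close> both factors are
    negative; elsewhere \<open>h'\<close> vanishes.\<close>
  have flux: "h' (x \<bullet> x) * (x \<bullet> V x) \<ge> 0" if x: "norm x < R" for x
  proof (cases "a < norm x \<and> norm x < b")
    case True
    then have "a\<^sup>2 < x \<bullet> x" "x \<bullet> x < b\<^sup>2"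
      using \<open>0 \<le> a\<close> by (auto simp flip: power2_norm_eq_inner intro!: power_strict_mono)
    then show ?thesis using h(7)[of "x \<bullet> x"] inward[of x] True x by (simp add: mult_nonpos_nonpos)
  next
    case False
    then show ?thesis
      using h0(2)[of x] h(6)[of "x \<bullet> x"] power_mono[of "norm x" a 2] \<open>0 \<le> a\<close>
      by (cases "b \<le> norm x") (auto simp: power2_norm_eq_inner)
  qed
  have nonneg: "(\<Sum>e\<in>Basis. F' e x) \<ge> 0" for x
  proof (cases "norm x < R")
    case True
    then show ?thesis
      using sumF'[OF True] flux[OF True] div[of x] h(3)[of "x \<bullet> x"] by simp
  qed (simp add: F'_def)
  have zero: "(\<Sum>e\<in>Basis. F' e x) = 0" for x
    by (rule continuous_nonneg_integral_eq_0[OF _ _ nonneg int0])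
      (use contF' intF' in \<open>auto intro!: continuous_on_sum\<close>)
  obtain e :: 'a where e: "e \<in> Basis" by (meson nonempty_Basis ex_in_conv)
  \<comment> \<open>Any point strictly inside the shell gives the contradiction: there the cutoff
    term is strictly positive, while the total was shown to be 0.\<close>
  define x where "x = ((a + b) / 2) *\<^sub>R e"
  have x: "a < norm x" "norm x < b" using b \<open>0 \<le> a\<close> e by (auto simp: x_def)
  then have "a\<^sup>2 < x \<bullet> x" "x \<bullet> x < b\<^sup>2"
    using \<open>0 \<le> a\<close> by (auto simp flip: power2_norm_eq_inner intro!: power_strict_mono)
  then have "h' (x \<bullet> x) * (x \<bullet> V x) > 0"
    using h(7)[of "x \<bullet> x"] inward[of x] x b by (simp add: mult_neg_neg)
  moreover have "h (x \<bullet> x) * (\<Sum>e\<in>Basis. DV x e \<bullet> e) \<ge> 0"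
    using div[of x] h(3)[of "x \<bullet> x"] x b by simp
  ultimately show False
    using zero[of x] sumF'[of x] x b by simp
qed

section \<open>From a lower bound on the divergence to a bound on the radius\<close>

text \<open>The curvature is bounded below in absolute value only; the constant sign
  \<open>\<epsilon>\<close> turns this into a one-sided bound on the divergence.\<close>

lemma continuous_nonvanishing_sign:
  fixes f :: "'a::topological_space \<Rightarrow> real"
  assumes "connected S" "continuous_on S f" "\<And>x. x \<in> S \<Longrightarrow> f x \<noteq> 0"
  obtains \<epsilon> :: real where "\<bar>\<epsilon>\<bar> = 1" "\<And>x. x \<in> S \<Longrightarrow> \<epsilon> * f x = \<bar>f x\<bar>"
proof (cases "\<exists>x\<in>S. f x < 0")
  case True
  have con: "connected (f ` S)" using assms by (intro connected_continuous_image)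
  have "f x < 0" if "x \<in> S" for x
    using True that assms(3) connectedD_interval[OF con, of _ "f x" 0]
    by (metis (no_types, lifting) imageE image_eqI less_le not_le)
  then show ?thesis by (intro that[of "-1"]) (auto simp: abs_of_neg)
next
  case False
  then show ?thesis by (intro that[of 1]) auto
qed

text \<open>The analytic core, free of Lorentz geometry: comparison with \<open>\<alpha> x\<close>,
  whose divergence is the dimension times \<open>\<alpha>\<close>. The exponent \<open>p\<close> may
  have either sign, so the bound is required away from the origin only.\<close>

lemma divergence_flux_bound:
  fixes W :: "'a::euclidean_space \<Rightarrow> 'a"
  assumes "R > 0" "\<alpha> > 0"
    and W: "\<And>x. x \<in> ball 0 R \<Longrightarrow> (W has_derivative DW x) (at x)"
    and cont: "\<And>e. e \<in> Basis \<Longrightarrow> continuous_on (ball 0 R) (\<lambda>x. DW x e)"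
    and div: "\<And>x. x \<in> ball 0 R \<Longrightarrow> \<bar>\<Sum>e\<in>Basis. DW x e \<bullet> e\<bar> \<ge> real DIM('a) * \<alpha>"
    and bound: "\<And>x. x \<in> ball 0 R \<Longrightarrow> x \<noteq> 0 \<Longrightarrow> norm (W x) \<le> M * norm x powr p"
  shows "\<alpha> \<le> M * R powr (p - 1)"
proof (rule ccontr)
  assume "\<not> ?thesis"
  then have less: "M * R powr (p - 1) < \<alpha>" by simp
  define d where "d x = (\<Sum>e\<in>Basis. DW x e \<bullet> e)" for x
  have "continuous_on (ball 0 R) d"
    unfolding d_def using cont by (intro continuous_intros) auto
  moreover have "d x \<noteq> 0" if "x \<in> ball 0 R" for x
    using div[OF that] \<open>\<alpha> > 0\<close> by (auto simp: d_def mult_le_0_iff)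
  ultimately obtain \<epsilon> where \<epsilon>: "\<bar>\<epsilon>\<bar> = 1" "\<And>x. x \<in> ball 0 R \<Longrightarrow> \<epsilon> * d x = \<bar>d x\<bar>"
    using continuous_nonvanishing_sign[OF connected_ball] by metis
  \<comment> \<open>By continuity the strict inequality at \<open>R\<close> persists for radii
    slightly below \<open>R\<close>; this yields the shell in which \<open>V\<close> would point
    inward.\<close>
  have "((\<lambda>s. M * s powr (p - 1)) \<longlongrightarrow> M * R powr (p - 1)) (at_left R)"
    using \<open>R > 0\<close> by (intro tendsto_intros) auto
  then have "eventually (\<lambda>s. M * s powr (p - 1) < \<alpha>) (at_left R)"
    using less by (rule order_tendstoD)
  then obtain a0 where a0: "a0 < R" "\<And>s. a0 < s \<Longrightarrow> s < R \<Longrightarrow> M * s powr (p - 1) < \<alpha>"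
    using \<open>R > 0\<close> by (auto simp: eventually_at_left[of 0])
  define V where "V x = \<epsilon> *\<^sub>R W x - \<alpha> *\<^sub>R x" for x
  define DV where "DV x v = \<epsilon> *\<^sub>R DW x v - \<alpha> *\<^sub>R v" for x v
  \<comment> \<open>\<open>a0\<close> may be negative; the maximum with 0 also ensures
    \<open>x \<noteq> 0\<close>, as \<open>bound\<close> demands.\<close>
  have "\<exists>x. max 0 a0 < norm x \<and> norm x < R \<and> x \<bullet> V x \<ge> 0"
  proof (rule divergence_nonneg_imp_outward)
    show "(V has_derivative DV x) (at x)" if "x \<in> ball 0 R" for x
      unfolding V_def DV_def by (intro derivative_intros W that)
    show "continuous_on (ball 0 R) (\<lambda>x. DV x e)" if "e \<in> Basis" for e
      unfolding DV_def by (intro continuous_intros cont that)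
    show "(\<Sum>e\<in>Basis. DV x e \<bullet> e) \<ge> 0" if "x \<in> ball 0 R" for x
    proof -
      have "(\<Sum>e\<in>Basis. DV x e \<bullet> e) = \<epsilon> * d x - real DIM('a) * \<alpha>"
        by (simp add: DV_def d_def inner_diff_left sum_subtractf sum_distrib_left)
      then show ?thesis using \<epsilon>(2)[OF that] div[OF that] by (simp add: d_def)
    qed
  qed (use a0 \<open>R > 0\<close> in auto)
  then obtain x where x: "0 < norm x" "a0 < norm x" "norm x < R" "x \<bullet> V x \<ge> 0" by auto
  have "\<alpha> * (norm x)\<^sup>2 \<le> x \<bullet> (\<epsilon> *\<^sub>R W x)"
    using x by (simp add: V_def inner_diff_right power2_norm_eq_inner)
  also have "\<dots> \<le> norm x * norm (W x)"
    using norm_cauchy_schwarz[of x "\<epsilon> *\<^sub>R W x"] \<epsilon>(1) by simp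
  also have "\<dots> \<le> norm x * (M * norm x powr p)"
    using x by (intro mult_left_mono bound) auto
  also have "\<dots> = M * norm x powr (p - 1) * (norm x)\<^sup>2"
    using x by (simp add: powr_diff power2_eq_square)
  also have "\<dots> < \<alpha> * (norm x)\<^sup>2"
    using x a0(2) by (intro mult_strict_right_mono) auto
  finally show False by simp
qed

section \<open>Coordinate derivatives, and the normalized gradient field\<close>

lemma partial_deriv_eq:
  assumes "(f has_derivative D) (at u)"
  shows "partial_deriv i f u = D (axis i 1)"
proof -
  have "((\<lambda>t. u + t *\<^sub>R axis i 1) has_derivative (\<lambda>t. t *\<^sub>R axis i 1)) (at 0)"
    by (auto intro!: derivative_eq_intros)
  from has_derivative_compose[OF this, of f D]
  have "((\<lambda>t. f (u + t *\<^sub>R axis i 1)) has_derivative (\<lambda>t. D (t *\<^sub>R axis i 1))) (at 0)"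
    using assms by simp
  moreover have "D (t *\<^sub>R axis i 1) = D (axis i 1) * t" for t
    using has_derivative_linear[OF assms] by (simp add: linear_cmul)
  ultimately show ?thesis
    unfolding partial_deriv_def by (intro DERIV_imp_deriv) (simp add: has_field_derivative_def)
qed

lemma divergence_eq:
  fixes F :: "real ^ 'n \<Rightarrow> real ^ 'n"
  assumes "(F has_derivative D) (at u)"
  shows "divergence F u = (\<Sum>e\<in>Basis. D e \<bullet> e)"
proof -
  have B: "(Basis :: (real ^ 'n) set) = range (\<lambda>i. axis i 1)"
    by (auto simp: Basis_vec_def)
  have inj: "inj (\<lambda>i. axis i 1 :: real ^ 'n)"
    by (auto simp: inj_def axis_eq_axis)
  have "partial_deriv i (\<lambda>x. F x $ i) u = D (axis i 1) \<bullet> axis i 1" for i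
    using partial_deriv_eq[OF bounded_linear.has_derivative[OF bounded_linear_vec_nth assms], of i i]
    by (simp add: inner_axis)
  then show ?thesis
    unfolding divergence_def B by (simp add: sum.reindex[OF inj])
qed

text \<open>The coordinates of the first derivative agree with \<open>grad \<psi>\<close> on
  \<open>S\<close> only, so openness is what transfers differentiability. Continuity is stated for
  each fixed direction \<open>v\<close>, the form in which the flux argument consumes it.\<close>

lemma C2_on_grad:
  fixes \<psi> :: "real ^ 'n \<Rightarrow> real"
  assumes "C2_on \<psi> S" "open S"
  obtains DG where "\<And>x. x \<in> S \<Longrightarrow> (grad \<psi> has_derivative DG x) (at x)"
    "\<And>v. continuous_on S (\<lambda>x. DG x v)"
proof -
  obtain f' :: "real ^ 'n \<Rightarrow> (real ^ 'n) \<Rightarrow>\<^sub>L real" and f'' where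
    f': "\<And>x. x \<in> S \<Longrightarrow> (\<psi> has_derivative blinfun_apply (f' x)) (at x)" and
    f'': "\<And>x. x \<in> S \<Longrightarrow> (f' has_derivative blinfun_apply (f'' x)) (at x)" "continuous_on S f''"
    using assms(1) unfolding C2_on_def by metis
  define G where "G x = (\<chi> i. f' x (axis i 1))" for x
  define DG where "DG x v = (\<chi> i. f'' x v (axis i 1))" for x v
  have "(G has_derivative DG x) (at x)" if "x \<in> S" for x
    unfolding has_derivative_componentwise_within[of G]
  proof
    fix b :: "real ^ 'n" assume "b \<in> Basis"
    then obtain i where b: "b = axis i 1" by (auto simp: Basis_vec_def)
    show "((\<lambda>x. G x \<bullet> b) has_derivative (\<lambda>v. DG x v \<bullet> b)) (at x)"
      unfolding b G_def DG_def inner_axis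
      by (auto intro!: derivative_eq_intros f''(1) that simp: blinfun.bilinear_simps)
  qed
  moreover have "G x = grad \<psi> x" if "x \<in> S" for x
    unfolding G_def grad_def using partial_deriv_eq[OF f'[OF that]] by simp
  ultimately have "(grad \<psi> has_derivative DG x) (at x)" if "x \<in> S" for x
    using that \<open>open S\<close> by (metis has_derivative_transform_within_open)
  moreover have "continuous_on S (\<lambda>x. DG x v)" for v
    unfolding DG_def
    by (intro continuous_on_vec_lambda continuous_intros f''(2))
  ultimately show ?thesis using that by blast
qed

text \<open>With \<open>\<sigma>\<close> equal to 1 or -1 this treats space-like and time-like
  graphs at once. The second term is the chain rule for the inverse square root: the factors -1/2
  and -2 cancel.\<close>

lemma has_derivative_lorentz_normalized:
  fixes G :: "'a::real_normed_vector \<Rightarrow> 'b::real_inner" and \<sigma> :: real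
  assumes G: "(G has_derivative DG) (at x)" and q: "\<sigma> * (1 - (norm (G x))\<^sup>2) > 0"
  shows "((\<lambda>x. G x /\<^sub>R sqrt (\<sigma> * (1 - (norm (G x))\<^sup>2))) has_derivative
    (\<lambda>v. DG v /\<^sub>R sqrt (\<sigma> * (1 - (norm (G x))\<^sup>2)) +
      (\<sigma> * (G x \<bullet> DG v) / sqrt (\<sigma> * (1 - (norm (G x))\<^sup>2)) ^ 3) *\<^sub>R G x)) (at x)"
proof -
  define q where "q x = \<sigma> * (1 - G x \<bullet> G x)" for x
  have "q x > 0" using assms by (simp add: q_def power2_norm_eq_inner)
  have "(q has_derivative (\<lambda>v. - 2 * \<sigma> * (G x \<bullet> DG v))) (at x)"
    unfolding q_def by (auto intro!: derivative_eq_intros G simp: inner_commute algebra_simps)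
  moreover have "((\<lambda>s. inverse (sqrt s)) has_real_derivative - 1 / (2 * sqrt (q x) ^ 3)) (at (q x))"
    using \<open>q x > 0\<close> by (auto intro!: derivative_eq_intros simp: field_simps power3_eq_cube)
  ultimately have "((\<lambda>x. inverse (sqrt (q x))) has_derivative (\<lambda>v. \<sigma> * (G x \<bullet> DG v) / sqrt (q x) ^ 3)) (at x)"
    unfolding has_field_derivative_def
    by (rule has_derivative_eq_rhs[OF has_derivative_compose]) (simp add: fun_eq_iff)
  then have "((\<lambda>x. G x /\<^sub>R sqrt (q x)) has_derivative
      (\<lambda>v. DG v /\<^sub>R sqrt (q x) + (\<sigma> * (G x \<bullet> DG v) / sqrt (q x) ^ 3) *\<^sub>R G x)) (at x)"
    by (rule has_derivative_eq_rhs[OF has_derivative_scaleR[OF _ G]]) (simp add: fun_eq_iff)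
  then show ?thesis by (simp add: q_def power2_norm_eq_inner)
qed

section \<open>The curvature estimate for graphs over a ball\<close>

theorem theorem2p1:
  fixes \<psi> :: "real ^ 'n \<Rightarrow> real" and R M k \<alpha> :: real
  assumes "R > 0"
    and "C2_on \<psi> (ball 0 R)"
    and "spacelike_graph (ball 0 R) \<psi> \<or> timelike_graph (ball 0 R) \<psi>"
    and "M > 0"
    and "\<And>u. u \<in> ball 0 R \<Longrightarrow>
           ereal (norm (grad \<psi> u) / sqrt \<bar>1 - (norm (grad \<psi> u))\<^sup>2\<bar>)
             \<le> ereal M * ext_power (\<Sum>i\<in>UNIV. (u $ i)\<^sup>2) k"
    and "\<alpha> > 0"
    and "\<And>u. u \<in> ball 0 R \<Longrightarrow> \<bar>graph_mean_curvature (ball 0 R) \<psi> u\<bar> \<ge> \<alpha>"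
  shows "\<alpha> \<le> M * R powr (2 * k - 1)"
proof -
  let ?B = "ball 0 R :: (real ^ 'n) set"
  \<comment> \<open>The case distinction mirrors the one in \<open>graph_mean_curvature\<close>, so
    the curvature is the divergence of \<open>W\<close> over the dimension in both cases.\<close>
  define \<sigma> :: real where "\<sigma> = (if spacelike_graph ?B \<psi> then 1 else -1)"
  define q where "q u = \<sigma> * (1 - (norm (grad \<psi> u))\<^sup>2)" for u
  have q: "q u > 0" if "u \<in> ?B" for u
    using assms(3) that
    by (auto simp: q_def \<sigma>_def spacelike_graph_def timelike_graph_def abs_square_less_1 one_less_power)
  have abs_q: "\<bar>1 - (norm (grad \<psi> u))\<^sup>2\<bar> = q u" if "u \<in> ?B" for u
    using q[OF that] by (auto simp: q_def \<sigma>_def split: if_splits)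
  define W where "W u = grad \<psi> u /\<^sub>R sqrt (q u)" for u
  have H: "graph_mean_curvature ?B \<psi> u = divergence W u / real CARD('n)" for u
    by (simp add: graph_mean_curvature_def W_def[abs_def] q_def[abs_def] \<sigma>_def)
  obtain DG where DG: "\<And>x. x \<in> ?B \<Longrightarrow> (grad \<psi> has_derivative DG x) (at x)"
    "\<And>v. continuous_on ?B (\<lambda>x. DG x v)"
    using C2_on_grad[OF assms(2) open_ball] by metis
  define DW where "DW x v = DG x v /\<^sub>R sqrt (q x) +
    (\<sigma> * (grad \<psi> x \<bullet> DG x v) / sqrt (q x) ^ 3) *\<^sub>R grad \<psi> x" for x v
  have DW: "(W has_derivative DW x) (at x)" if "x \<in> ?B" for x
    using has_derivative_lorentz_normalized[OF DG(1)[OF that], of \<sigma>] q[OF that]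
    unfolding W_def[abs_def] DW_def[abs_def] q_def by simp
  have "continuous_on ?B (grad \<psi>)"
    using DG(1) by (meson continuous_at_imp_continuous_on has_derivative_continuous)
  moreover from this have "continuous_on ?B q"
    unfolding q_def by (intro continuous_intros)
  ultimately have cont: "continuous_on ?B (\<lambda>x. DW x v)" for v
    unfolding DW_def using q DG(2) by (intro continuous_intros) (auto simp: less_le)
  show ?thesis
  proof (rule divergence_flux_bound[OF assms(1,6) DW cont])
    show "real DIM(real ^ 'n) * \<alpha> \<le> \<bar>\<Sum>e\<in>Basis. DW x e \<bullet> e\<bar>" if "x \<in> ?B" for x
      using assms(7)[OF that] divergence_eq[OF DW[OF that]]
      by (simp add: H abs_divide field_simps)
    \<comment> \<open>The hypothesis bounds by a power of the squared norm, hence the exponent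
      \<open>2 * k\<close>. Away from the origin \<open>ext_power\<close> is an ordinary real
      power.\<close>
    show "norm (W x) \<le> M * norm x powr (2 * k)" if x: "x \<in> ?B" "x \<noteq> 0" for x
    proof -
      have "(\<Sum>i\<in>UNIV. (x $ i)\<^sup>2) = (norm x)\<^sup>2"
        by (simp add: norm_vec_def L2_set_def sum_nonneg)
      moreover have "((norm x)\<^sup>2) powr k = norm x powr (2 * k)"
        using x powr_powr[of "norm x" 2 k] by simp
      ultimately have "norm (grad \<psi> x) / sqrt (q x) \<le> M * norm x powr (2 * k)"
        using assms(5)[OF x(1)] x(2) by (simp add: ext_power_def abs_q[OF x(1)])
      then show ?thesis using q[OF x(1)] by (simp add: W_def divide_inverse mult.commute)
    qed
  qed
qed

end
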